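(* Let $p,q>1$ be coprime integers and let $\mu$ be a non-atomic Borel probability measure on $\mathbb{T}=\mathbb{R}/\mathbb{Z}$ that is both $p$-invariant and $q$-invariant. If $\mu$ exhibits balanced geometry for one of these two actions (that is, for the $p$-action or for the $q$-action), then $\mu$ is the Lebesgue probability measure $\mu_0$ on $\mathbb{T}$.
   Context: For an integer $p>1$, the $p$-action on $\mathbb{T}$ is $f_p(x)=px \pmod 1$. A measure $\mu$ is $p$-invariant if $\mu(f_p^{-1}(A))=\mu(A)$ for every Borel set $A\subseteq\mathbb{T}$. For $n\ge 0$ let $\Sigma_n$ be the set of words $w_n=i_0i_1\cdots i_{n-1}$ of length $n$ over the alphabet $\{0,1,\dots,p-1\}$ ($\Sigma_0$ consists of the empty word). For $0\le i\le p-1$ let $I_i=[\frac{i}{p},\frac{i+1}{p}]$ (an arc of $\mathbb{T}$), and for $w_n=i_0\cdots i_{n-1}\in\Sigma_n$ with $n\geq 1$ let $I_{w_n}=I_{i_0}\cap f_p^{-1}(I_{i_1})\cap\cdots\cap f_p^{-(n-1)}(I_{i_{n-1}})$. Up to finitely many points (irrelevant for non-atomic measures) this is the arc $[\frac{k}{p^n},\frac{k+1}{p^n}]$ with $k=\sum_{j=0}^{n-1} i_j p^{n-1-j}$. For a word $w$ and a letter $i$, $iw$ denotes the word obtained by putting $i$ in front of $w$. Balanced geometry for the $p$-action: for a non-atomic Borel probability measure $\mu$ on $\mathbb{T}$ and $n\ge 1$ define $$\alpha(n-1)=\min_{w_{n-1}\in\Sigma_{n-1},\;0\le i\le p-1}\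 \frac{\sum_{0\le j\le p-1,\ j\ne i}\mu(I_{jw_{n-1}})}{\mu(I_{iw_{n-1}})},$$ where a ratio with zero denominator is regarded as imposing no constraint (value $+\infty$). The measure $\mu$ exhibits balanced geometry for the $p$-action if there is a constant $C>0$ with $\alpha(n-1)\ge C$ for all $n\ge 1$. Balanced geometry for the $q$-action is defined in the same way with $q$ in place of $p$. *)

theory Defs
  imports "HOL-Probability.Probability"
begin

text \<open>The circle \<open>\<real>/\<int>\<close>, with the quotient topology; \<open>to_circle\<close> is the canonical projection.\<close>

quotient_type circle = real / "\<lambda>x y :: real. x - y \<in> \<int>"
  morphisms rep_circle to_circle
proof (rule equivpI)
  show "reflp (\<lambda>x y :: real. x - y \<in> \<int>)"
    by (auto intro: reflpI)
  show "symp (\<lambda>x y :: real. x - y \<in> \<int>)"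
    by (rule sympI) (metis Ints_minus minus_diff_eq)
  show "transp (\<lambda>x y :: real. x - y \<in> \<int>)"
  proof (rule transpI)
    fix x y z :: real
    assume "x - y \<in> \<int>" "y - z \<in> \<int>"
    then have "(x - y) + (y - z) \<in> \<int>" by (rule Ints_add)
    then show "x - z \<in> \<int>" by simp
  qed
qed

lemma to_circle_eq_iff: "to_circle x = to_circle y \<longleftrightarrow> x - y \<in> \<int>"
  by (rule circle.abs_eq_iff)

instantiation circle :: topological_space
begin

definition open_circle :: "circle set \<Rightarrow> bool" where
  "open_circle U \<longleftrightarrow> open (to_circle -` U)"

instance
  by standard (auto simp: open_circle_def vimage_Union)

end

lemma continuous_on_to_circle: "continuous_on A to_circle"
  by (rule continuous_on_subset[of UNIV]) (auto simp: continuous_on_open_vimage open_circle_def)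

lemma measurable_to_circle [measurable]: "to_circle \<in> borel_measurable borel"
  by (intro borel_measurable_continuous_onI continuous_on_to_circle)

text \<open>In particular singletons are Borel sets.\<close>

instance circle :: t1_space
proof
  fix x y :: circle
  assume "x \<noteq> y"
  obtain b where b: "y = to_circle b"
    by (metis Quotient3_abs_rep[OF Quotient3_circle])
  have "to_circle -` (- {y}) = - ((\<lambda>r. r - b) -` \<int>)"
    by (auto simp: b to_circle_eq_iff)
  moreover have "closed ((\<lambda>r. r - b) -` \<int>)"
    by (intro closed_vimage closed_Ints continuous_intros)
  ultimately have "open (- {y})"
    by (simp add: open_circle_def open_closed)
  with \<open>x \<noteq> y\<close> show "\<exists>U. open U \<and> x \<in> U \<and> y \<notin> U"
    by (intro exI[of _ "- {y}"]) auto
qed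

lift_definition times_map :: "nat \<Rightarrow> circle \<Rightarrow> circle" is "\<lambda>p x. real p * x"
  by (metis Ints_mult Ints_of_nat right_diff_distrib)

lemma continuous_on_times_map: "continuous_on A (times_map p)"
proof (rule continuous_on_subset[of UNIV])
  have "to_circle -` (times_map p -` U) = (\<lambda>x. real p * x) -` (to_circle -` U)" for U
    by (auto simp: times_map.abs_eq)
  then show "continuous_on UNIV (times_map p)"
    by (auto simp: continuous_on_open_vimage open_circle_def intro!: open_vimage continuous_intros)
qed auto

lemma measurable_times_map [measurable]: "times_map p \<in> borel_measurable borel"
  by (intro borel_measurable_continuous_onI continuous_on_times_map)

definition times_invariant :: "nat \<Rightarrow> circle measure \<Rightarrow> bool" where
  "times_invariant p M \<longleftrightarrow>
     (\<forall>A \<in> sets borel. emeasure M (times_map p -` A) = emeasure M A)"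

definition words :: "nat \<Rightarrow> nat \<Rightarrow> nat list set" where
  "words p n = {w. length w = n \<and> set w \<subseteq> {..<p}}"

definition arc :: "nat \<Rightarrow> nat \<Rightarrow> circle set" where
  "arc p i = to_circle ` {real i / real p .. (real i + 1) / real p}"

definition cylinder :: "nat \<Rightarrow> nat list \<Rightarrow> circle set" where
  "cylinder p w = (\<Inter>j<length w. (times_map p ^^ j) -` arc p (w ! j))"

text \<open>The case distinction is needed because \<open>0 / 0 = 0\<close> in \<^typ>\<open>ennreal\<close>.\<close>

definition sibling_ratio :: "nat \<Rightarrow> circle measure \<Rightarrow> nat list \<Rightarrow> nat \<Rightarrow> ennreal" where
  "sibling_ratio p M w i =
     (if emeasure M (cylinder p (i # w)) = 0 then \<infinity>
      else (\<Sum>j\<in>{..<p} - {i}. emeasure M (cylinder p (j # w))) / emeasure M (cylinder p (i # w)))"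

definition balance :: "nat \<Rightarrow> circle measure \<Rightarrow> nat \<Rightarrow> ennreal" where
  "balance p M m = Min ((\<lambda>(w, i). sibling_ratio p M w i) ` (words p m \<times> {..<p}))"

definition balanced_geometry :: "nat \<Rightarrow> circle measure \<Rightarrow> bool" where
  "balanced_geometry p M \<longleftrightarrow> (\<exists>C::real. C > 0 \<and> (\<forall>n\<ge>1. balance p M (n - 1) \<ge> ennreal C))"

definition lebesgue_circle :: "circle measure" where
  "lebesgue_circle = distr (restrict_space lborel {0..<1}) borel to_circle"

lemma emeasure_lebesgue_circle:
  assumes "A \<in> sets borel"
  shows "emeasure lebesgue_circle A = emeasure lborel (to_circle -` A \<inter> {0..<1})"
proof -
  have "to_circle \<in> measurable (restrict_space lborel {0..<1}) borel"
    by (rule measurable_restrict_space1) simp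
  with assms show ?thesis
    by (simp add: lebesgue_circle_def emeasure_distr space_restrict_space emeasure_restrict_space)
qed

lemma prob_space_lebesgue_circle: "prob_space lebesgue_circle"
proof (rule prob_spaceI)
  have "space lebesgue_circle = UNIV"
    by (simp add: lebesgue_circle_def)
  then show "emeasure lebesgue_circle (space lebesgue_circle) = 1"
    by (simp add: emeasure_lebesgue_circle)
qed

end

theory Submission
  imports Defs "HOL-Number_Theory.Residues"
begin

text \<open>
  Suppose balanced geometry holds for \<open>p\<close> with constant \<open>C\<close>, and let \<open>c = 1 / (1 + C) < 1\<close>. Together with
  \<open>p\<close>-invariance this says that prepending a letter to a word shrinks the measure of its arc by at
  least the factor \<open>c\<close>. Approximating integrals by sums over arcs gives, for continuous \<open>F \<ge> 0\<close>,
  \<open>\<integral> F d\<mu> \<le> c\<^sup>n \<integral> (\<Sum>j<p\<^sup>n. F ((x + j) / p\<^sup>n)) d\<mu>\<close>.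

  Apply this to \<open>F = |G|\<^sup>2\<close>, where \<open>G\<close> is the mean of the characters of frequency \<open>m Q\<^sup>k\<close>, \<open>k < p\<^sup>n\<close>, and
  \<open>Q\<close> is a power of \<open>q\<close> with \<open>Q \<equiv> 1 (mod p\<^sup>2)\<close>. By \<open>q\<close>-invariance \<open>\<integral> G d\<mu>\<close> is the \<open>m\<close>-th Fourier
  coefficient of \<open>\<mu>\<close>, while the sum over \<open>j\<close> is at most \<open>p\<^sup>-\<^sup>n\<close> times the number of pairs \<open>k, l\<close> with
  \<open>p\<^sup>n dvd m (Q\<^sup>k - Q\<^sup>l)\<close>. Lifting the exponent bounds this number by a constant multiple of \<open>p\<^sup>n\<close>, so
  the coefficient is \<open>O(c\<^bsup>n/2\<^esup>)\<close> for every \<open>n\<close>, that is, zero for \<open>m \<noteq> 0\<close>.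
\<close>

section \<open>Counting solutions of a divisibility\<close>

text \<open>
  The hypothesis on \<open>r\<^sup>2\<close> instead of \<open>r\<close> gives \<open>1 + y + \<dots> + y\<^bsup>r-1\<^esup> \<equiv> r (mod r\<^sup>2)\<close> for \<open>y = Q\<^sup>d\<close> also when
  \<open>r = 2\<close>, so each factor \<open>r\<close> of the exponent contributes exactly one factor \<open>r\<close>.
\<close>

lemma prime_power_dvd_power_diff_1:
  fixes Q m r :: int
  assumes r: "prime r" and Q: "r\<^sup>2 dvd Q - 1" and "r ^ a dvd m * (Q ^ d - 1)"
  shows "r ^ a dvd m * (Q - 1) * int d"
  using assms(3)
proof (induction d arbitrary: m rule: less_induct)
  case (less d)
  have geom: "r\<^sup>2 dvd (\<Sum>i<t. (y::int) ^ i) - int t" if "r\<^sup>2 dvd y - 1" for y t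
  proof -
    have "(\<Sum>i<t. y ^ i) - int t = (\<Sum>i<t. y ^ i - 1)"
      by (simp add: sum_subtractf)
    moreover have "r\<^sup>2 dvd y ^ i - 1" for i
      using that by (metis dvd_trans dvd_triv_left power_diff_1_eq)
    ultimately show ?thesis
      by (simp add: dvd_sum)
  qed
  consider "d = 0" | "\<not> r dvd int d" | "d \<noteq> 0" "r dvd int d" by blast
  then show ?case
  proof cases
    case 1
    then show ?thesis by simp
  next
    case 2
    \<comment> \<open>\<open>S\<close> is congruent to \<open>d\<close> modulo \<open>r\<close>,
      hence prime to \<open>r\<close>, and cancels from
      \<open>Q ^ d - 1 = (Q - 1) * S\<close>.\<close>
    define S where "S = (\<Sum>i<d. Q ^ i)"
    have "r dvd S - int d"
      using geom[OF Q, of d] unfolding S_def by (metis dvd_trans dvd_power zero_less_numeral)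
    then have "\<not> r dvd S"
      using 2 by (metis dvd_diff_right_iff dvd_diff_commute)
    then have "coprime (r ^ a) S"
      using r by (simp add: prime_imp_coprime)
    moreover have "r ^ a dvd (m * (Q - 1)) * S"
      using less.prems by (simp add: S_def power_diff_1_eq mult.assoc)
    ultimately show ?thesis
      by (simp add: coprime_dvd_mult_left_iff)
  next
    case 3
    have r0: "r \<ge> 2" using r by (rule prime_ge_2_int)
    from 3 obtain c where c: "int d = r * c" by blast
    have c0: "c > 0"
      using c 3 r0 by (smt (verit) mult_nonneg_nonpos of_nat_0_less_iff zero_less_iff_neq_zero)
    define d' where "d' = nat c"
    have d: "d = nat r * d'"
      using c c0 r0 unfolding d'_def by (metis nat_int nat_mult_distrib order.trans zero_le_numeral)
    have d'd: "d' < d"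
      unfolding d using c0 r0 by (intro n_less_m_mult_n) (auto simp: d'_def)
    define y where "y = Q ^ d'"
    define T where "T = (\<Sum>i<nat r. y ^ i)"
    have yQ: "r\<^sup>2 dvd y - 1"
      unfolding y_def using Q by (metis dvd_trans dvd_triv_left power_diff_1_eq)
    obtain t where t: "T - r = r\<^sup>2 * t"
      using geom[OF yQ, of "nat r"] r0 by (auto simp: T_def)
    have T: "T = r * (1 + r * t)"
      using t by (simp add: algebra_simps power2_eq_square)
    have "Q ^ d - 1 = y ^ nat r - 1"
      by (simp add: y_def d power_mult mult.commute flip: power_mult)
    also have "\<dots> = (y - 1) * T"
      by (simp add: T_def power_diff_1_eq)
    also have "\<dots> = (y - 1) * (r * (1 + r * t))"
      using T by simp
    finally have "r ^ a dvd m * ((y - 1) * (r * (1 + r * t)))"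
      using less.prems by simp
    then have "r ^ a dvd (m * r * (y - 1)) * (1 + r * t)"
      by (simp only: mult_ac)
    moreover have "coprime (r ^ a) (1 + r * t)"
    proof -
      have "\<not> r dvd 1 + r * t"
        using r by (metis dvd_add_left_iff dvd_triv_left not_prime_unit)
      then show ?thesis using r by (simp add: prime_imp_coprime)
    qed
    \<comment> \<open>The single factor \<open>r\<close> taken from the exponent moves into the
      multiplier, which is why the induction runs over arbitrary \<open>m\<close>; it returns
      through \<open>d = r * d'\<close>.\<close>
    ultimately have "r ^ a dvd m * r * (Q ^ d' - 1)"
      by (simp add: coprime_dvd_mult_left_iff y_def)
    from less.IH[OF d'd this] show ?thesis
      using c c0 by (simp add: d'_def algebra_simps)
  qed
qed

text \<open>It suffices to compare exponents prime by prime, where the prime power case applies.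
  Multiplicities are informative only for a nonzero right-hand side, so a vanishing product is
  treated apart.\<close>

lemma dvd_power_diff_1_imp:
  fixes Q m P :: int
  assumes "P \<noteq> 0" and Q: "\<And>r. prime r \<Longrightarrow> r dvd P \<Longrightarrow> r\<^sup>2 dvd Q - 1"
    and dvd: "P dvd m * (Q ^ d - 1)"
  shows "P dvd m * (Q - 1) * int d"
proof (cases "m * (Q - 1) * int d = 0")
  case True
  then show ?thesis by (simp only: dvd_0_right)
next
  case False
  show ?thesis
  proof (rule multiplicity_le_imp_dvd[OF \<open>P \<noteq> 0\<close>])
    fix r :: int assume r: "prime r"
    show "multiplicity r P \<le> multiplicity r (m * (Q - 1) * int d)"
    proof (cases "r dvd P")
      case True
      have "r ^ multiplicity r P dvd m * (Q ^ d - 1)"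
        using multiplicity_dvd dvd by (rule dvd_trans)
      from prime_power_dvd_power_diff_1[OF r Q[OF r True] this] show ?thesis
        using False r by (intro multiplicity_geI) auto
    qed (simp add: not_dvd_imp_multiplicity_0)
  qed
qed

text \<open>Since \<open>k\<close> and \<open>l\<close> differ by less than \<open>P\<close>, the
  quotient \<open>A * (k - l) / P\<close> is an integer of absolute value below that of
  \<open>A\<close>, and it determines \<open>k\<close>.\<close>

lemma card_dvd_mult_diff_le:
  fixes P :: nat and A :: int
  assumes "P > 0" "A \<noteq> 0" and l: "l < P"
  shows "card {k. k < P \<and> int P dvd A * (int k - int l)} \<le> 2 * nat \<bar>A\<bar>"
proof -
  let ?S = "{k. k < P \<and> int P dvd A * (int k - int l)}"
  let ?f = "\<lambda>k. A * (int k - int l) div int P"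
  have "inj_on ?f ?S"
    using assms by (auto simp: inj_on_def dvd_div_eq_iff)
  moreover have "?f ` ?S \<subseteq> {-\<bar>A\<bar>..<\<bar>A\<bar>}"
  proof clarify
    fix k assume k: "k < P" "int P dvd A * (int k - int l)"
    then obtain t where t: "A * (int k - int l) = int P * t" by blast
    have "int P * \<bar>t\<bar> = \<bar>A\<bar> * \<bar>int k - int l\<bar>"
      using t by (metis abs_mult abs_of_nat)
    also have "\<dots> < \<bar>A\<bar> * int P"
      using assms k(1) l by (intro mult_strict_left_mono) auto
    finally have "\<bar>t\<bar> < \<bar>A\<bar>"
      using assms by (simp add: mult.commute)
    then show "?f k \<in> {-\<bar>A\<bar>..<\<bar>A\<bar>}"
      using t assms by auto
  qed
  ultimately have "card ?S \<le> card {-\<bar>A\<bar>..<\<bar>A\<bar>}"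
    by (intro card_inj_on_le) auto
  then show ?thesis by simp
qed

text \<open>After cancelling the smaller power of \<open>Q\<close>, which is prime to
  \<open>P\<close>, lifting the exponent turns the exponential congruence into a linear one in
  \<open>k - l\<close>. For each \<open>l\<close> that one has boundedly many solutions, so the
  count is linear in \<open>P\<close> with a constant independent of \<open>P\<close>.\<close>

lemma card_power_diff_pairs_le:
  fixes P :: nat and Q m :: int
  assumes P: "P > 0" and m: "m \<noteq> 0" "Q > 1" and "coprime (int P) Q"
    and Q: "\<And>r. prime r \<Longrightarrow> r dvd int P \<Longrightarrow> r\<^sup>2 dvd Q - 1"
  shows "card {(l, k). l < P \<and> k < P \<and> int P dvd m * (Q ^ k - Q ^ l)} \<le> P * (2 * nat \<bar>m * (Q - 1)\<bar>)"
proof -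
  have aux: "int P dvd m * (Q - 1) * (int k - int l)" 
    if "int P dvd m * (Q ^ k - Q ^ l)" "l \<le> k" for k l
  proof -
    have "Q ^ k - Q ^ l = (Q ^ (k - l) - 1) * Q ^ l"
      using that(2) by (simp add: left_diff_distrib flip: power_add)
    then have "int P dvd (m * (Q ^ (k - l) - 1)) * Q ^ l"
      using that(1) by (simp add: mult.assoc)
    then have "int P dvd m * (Q ^ (k - l) - 1)"
      using assms(4) by (simp add: coprime_dvd_mult_left_iff)
    from dvd_power_diff_1_imp[OF _ Q this] show ?thesis
      using P that(2) by (simp add: of_nat_diff)
  qed
  have sub: "{(l, k). l < P \<and> k < P \<and> int P dvd m * (Q ^ k - Q ^ l)}
    \<subseteq> (SIGMA l:{..<P}. {k. k < P \<and> int P dvd (m * (Q - 1)) * (int k - int l)})"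
  proof clarsimp
    fix l k assume *: "int P dvd m * (Q ^ k - Q ^ l)"
    \<comment> \<open>\<open>aux\<close> wants the larger exponent first; both divisibilities
      survive a change of sign, so the other order follows by exchanging \<open>k\<close> and
      \<open>l\<close>.\<close>
    then have "int P dvd m * (Q ^ l - Q ^ k)"
      by (metis dvd_minus_iff minus_diff_eq mult_minus_right)
    then show "int P dvd m * (Q - 1) * (int k - int l)"
      using aux[of k l] aux[of l k] * 
      by (metis dvd_minus_iff minus_diff_eq mult_minus_right nat_le_linear)
  qed
  have "card {(l, k). l < P \<and> k < P \<and> int P dvd m * (Q ^ k - Q ^ l)}
    \<le> card (SIGMA l:{..<P}. {k. k < P \<and> int P dvd (m * (Q - 1)) * (int k - int l)})"
    by (rule card_mono[OF _ sub]) auto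
  also have "\<dots> = (\<Sum>l<P. card {k. k < P \<and> int P dvd (m * (Q - 1)) * (int k - int l)})"
    by (subst card_SigmaI) auto
  also have "\<dots> \<le> (\<Sum>l<P. 2 * nat \<bar>m * (Q - 1)\<bar>)"
    using m P by (intro sum_mono card_dvd_mult_diff_le) auto
  finally show ?thesis by simp
qed

section \<open>Characters of the circle\<close>

definition circle_char :: "int \<Rightarrow> real \<Rightarrow> complex" where
  "circle_char k x = cis (2 * pi * of_int k * x)"

lemma circle_char_0 [simp]: "circle_char 0 x = 1"
  by (simp add: circle_char_def)

lemma norm_circle_char [simp]: "norm (circle_char k x) = 1"
  by (simp add: circle_char_def)

lemma circle_char_mult: "circle_char k x * circle_char l x = circle_char (k + l) x"
  by (simp add: circle_char_def cis_mult algebra_simps)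

lemma cnj_circle_char: "cnj (circle_char k x) = circle_char (- k) x"
  by (simp add: circle_char_def cis_cnj)

lemma circle_char_of_int_mult: "circle_char (int n * k) x = circle_char k (real n * x)"
  by (simp add: circle_char_def algebra_simps)

lemma circle_char_add_int: "j \<in> \<int> \<Longrightarrow> circle_char k (x + j) = circle_char k x"
proof -
  assume "j \<in> \<int>"
  then obtain i where i: "j = of_int i" by (rule Ints_cases)
  have "circle_char k (x + j) = circle_char k x * cis (2 * pi * of_int (k * i))"
    by (simp add: i circle_char_def cis_mult algebra_simps)
  then show ?thesis by (subst (asm) cis_multiple_2pi) auto
qed

lemma circle_char_frac: "circle_char k (frac x) = circle_char k x"
  using circle_char_add_int[of "of_int \<lfloor>x\<rfloor>" k "frac x"] by (simp add: frac_def)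

lemma continuous_on_circle_char [continuous_intros]:
  "continuous_on A f \<Longrightarrow> continuous_on A (\<lambda>x. circle_char k (f x))"
  unfolding circle_char_def by (intro continuous_intros)

lemma borel_measurable_circle_char [measurable]: "circle_char k \<in> borel_measurable borel"
  by (intro borel_measurable_continuous_onI continuous_intros)

lemma cis_eq_1_imp: "cis (2 * pi * x) = 1 \<Longrightarrow> x \<in> \<int>"
proof -
  assume "cis (2 * pi * x) = 1"
  then have "cos (2 * pi * x) = 1" by (metis cis.sel(1) one_complex.sel(1))
  then obtain n :: int where "2 * pi * x = of_int n * 2 * pi"
    unfolding cos_one_2pi_int by blast
  then show "x \<in> \<int>" by simp
qed

text \<open>The points \<open>(x + j) / P\<close> are the preimages of \<open>x\<close> under
  multiplication by \<open>P\<close> modulo 1. Along them the character is a geometric progression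
  whose ratio \<open>w\<close> is a \<open>P\<close>-th root of unity, equal to 1 exactly when
  \<open>P\<close> divides \<open>a\<close>.\<close>

lemma sum_circle_char_preimages:
  assumes "P > 0"
  shows "(\<Sum>j<P. circle_char a ((x + real j) / real P)) =
    (if int P dvd a then of_nat P * circle_char a (x / real P) else 0)"
proof -
  define w where "w = cis (2 * pi * (of_int a / real P))"
  have eq: "circle_char a ((x + real j) / real P) = circle_char a (x / real P) * w ^ j" for j
    using assms
    by (simp add: circle_char_def w_def Complex.DeMoivre cis_mult algebra_simps add_divide_distrib)
  have wP: "w ^ P = 1"
  proof -
    have "w ^ P = cis (2 * pi * of_int a)"
      using assms by (simp add: w_def Complex.DeMoivre)
    then show ?thesis by (simp add: cis_multiple_2pi)
  qed
  show ?thesis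
  proof (cases "int P dvd a")
    case True
    then obtain b where "a = int P * b" by blast
    then have "w = cis (2 * pi * of_int b)"
      using assms by (simp add: w_def)
    then have "w = 1" by (simp add: cis_multiple_2pi)
    with True show ?thesis by (simp add: eq)
  next
    case False
    have "w \<noteq> 1"
    proof
      assume "w = 1"
      then have "of_int a / real P \<in> \<int>"
        unfolding w_def by (rule cis_eq_1_imp)
      then obtain b where "of_int a / real P = of_int b" by (rule Ints_cases)
      then have "real_of_int a = of_int (int P * b)"
        using assms by (simp add: field_simps)
      then have "a = int P * b" by (simp only: of_int_eq_iff)
      with False show False by simp
    qed
    then have "(\<Sum>j<P. w ^ j) = 0"
      using wP by (simp add: geometric_sum)
    with False show ?thesis by (simp add: eq flip: sum_distrib_left)
  qed
qed

definition char_mean :: "nat \<Rightarrow> (nat \<Rightarrow> int) \<Rightarrow> real \<Rightarrow> complex" where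
  "char_mean N c x = (\<Sum>k<N. circle_char (c k) x) / of_nat N"

lemma continuous_on_char_mean [continuous_intros]: "continuous_on A (char_mean N c)"
  unfolding char_mean_def divide_inverse by (intro continuous_intros)

text \<open>Expanding the square gives characters of frequency \<open>c k - c l\<close>. Summation
  over the preimages kills those with frequency not divisible by \<open>P\<close>; each survivor has
  modulus \<open>P\<close>, against the normalisation by the square of \<open>P\<close>.\<close>

lemma sum_preimages_char_mean:
  assumes P: "P > 0"
  shows "(\<Sum>j<P. (norm (char_mean P c ((x + real j) / real P)))\<^sup>2)
    \<le> real (card {(l, k). l < P \<and> k < P \<and> int P dvd c k - c l}) / real P"
proof -
  let ?D = "{(l, k). l < P \<and> k < P \<and> int P dvd c k - c l}"
  let ?y = "\<lambda>j. (x + real j) / real P"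
  have sq: "complex_of_real ((norm (char_mean P c y))\<^sup>2) =
      (\<Sum>l<P. \<Sum>k<P. circle_char (c k - c l) y) / (of_nat P)\<^sup>2" for y
  proof -
    have "(\<Sum>l<P. \<Sum>k<P. circle_char (c k - c l) y) =
        (\<Sum>k<P. circle_char (c k) y) * (\<Sum>l<P. cnj (circle_char (c l) y))"
      by (subst sum.swap) (simp add: sum_product cnj_circle_char circle_char_mult)
    then show ?thesis
      by (simp only: complex_norm_square char_mean_def) (simp add: power2_eq_square)
  qed
  have "complex_of_real (\<Sum>j<P. (norm (char_mean P c (?y j)))\<^sup>2)
     = (\<Sum>j<P. (\<Sum>l<P. \<Sum>k<P. circle_char (c k - c l) (?y j)) / (of_nat P)\<^sup>2)"
    by (simp only: of_real_sum sq)
  also have "\<dots> = (\<Sum>l<P. \<Sum>k<P. \<Sum>j<P. circle_char (c k - c l) (?y j)) / (of_nat P)\<^sup>2"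
    by (simp only: flip: sum_divide_distrib)
      (subst sum.swap, intro arg_cong2[where f = "(/)"] sum.cong refl sum.swap)
  finally have eq: "complex_of_real (\<Sum>j<P. (norm (char_mean P c (?y j)))\<^sup>2) =
     (\<Sum>l<P. \<Sum>k<P. \<Sum>j<P. circle_char (c k - c l) (?y j)) / (of_nat P)\<^sup>2" .
  have "(\<Sum>j<P. (norm (char_mean P c (?y j)))\<^sup>2) =
      norm (complex_of_real (\<Sum>j<P. (norm (char_mean P c (?y j)))\<^sup>2))"
    by (simp only: norm_of_real) (simp add: sum_nonneg)
  also have "\<dots> = norm (\<Sum>l<P. \<Sum>k<P. \<Sum>j<P. circle_char (c k - c l) (?y j)) / (real P)\<^sup>2"
    by (simp only: eq norm_divide norm_power norm_of_nat)
  also have "\<dots> \<le> (\<Sum>l<P. \<Sum>k<P. if int P dvd c k - c l then real P else 0) / (real P)\<^sup>2"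
    using P by (intro divide_right_mono sum_norm_le)
      (auto simp: sum_circle_char_preimages norm_mult)
  also have "(\<Sum>l<P. \<Sum>k<P. if int P dvd c k - c l then real P else 0) =
      (\<Sum>z\<in>{..<P}\<times>{..<P}. if z \<in> ?D then real P else 0)"
    by (simp add: sum.cartesian_product case_prod_beta) (rule sum.cong, auto)
  also have "\<dots> = (\<Sum>z\<in>?D. real P)"
    by (rule sum.mono_neutral_cong_right) auto
  also have "\<dots> / (real P)\<^sup>2 = real (card ?D) / real P"
    using P by (simp add: power2_eq_square)
  finally show ?thesis .
qed

section \<open>Measures on the unit interval\<close>

text \<open>Half-open, unlike the closed arcs, so that the cells with \<open>k < P\<close> partition
  [0,1) exactly and membership becomes a statement about \<open>floor\<close>.\<close>

definition cell :: "nat \<Rightarrow> nat \<Rightarrow> real set" where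
  "cell P k = {real k / real P..<(real k + 1) / real P}"

lemma cell_borel [measurable]: "cell P k \<in> sets borel"
  by (simp add: cell_def)

lemma borel_measurable_frac [measurable]: "frac \<in> borel_measurable (borel :: real measure)"
  unfolding frac_def[abs_def] by measurable

lemma mem_cell_iff: "P > 0 \<Longrightarrow> x \<in> cell P k \<longleftrightarrow> \<lfloor>real P * x\<rfloor> = int k"
  by (auto simp: cell_def floor_eq_iff field_simps)

lemma sum_lessThan_mult:
  fixes f :: "nat \<Rightarrow> 'a::comm_monoid_add"
  shows "(\<Sum>k<a * b. f k) = (\<Sum>j<a. \<Sum>r<b. f (j * b + r))"
proof -
  have "sum f {j * b..<j * b + b} = (\<Sum>r<b. f (j * b + r))" for j
    using sum.shift_bounds_nat_ivl[of f 0 "j * b" b]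
    by (simp add: atLeast0LessThan add.commute)
  then show ?thesis
    using sum.nat_group[of f b a] by simp
qed

text \<open>Circle measures are studied through representatives in [0,1). Keeping all Borel sets of
  the line and imposing the support almost everywhere avoids restricted spaces.\<close>

locale unit_interval_measure = prob_space \<nu> for \<nu> :: "real measure" +
  assumes sets_eq [measurable_cong, simp]: "sets \<nu> = sets borel"
    and AE_unit: "AE x in \<nu>. 0 \<le> x \<and> x < 1"
begin

lemma integrable_continuous:
  fixes f :: "real \<Rightarrow> 'b::euclidean_space"
  assumes "continuous_on UNIV f"
  shows "integrable \<nu> f"
proof -
  have "bounded (f ` {0..1})"
    by (intro compact_imp_bounded compact_continuous_image continuous_on_subset[OF assms]) auto
  then obtain B where "\<forall>y\<in>f ` {0..1}. norm y \<le> B"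
    by (auto simp: bounded_iff)
  moreover have "f \<in> borel_measurable \<nu>"
    using borel_measurable_continuous_onI[OF assms] by simp
  ultimately show ?thesis
    using AE_unit by (intro integrable_const_bound[of _ B]) auto
qed

text \<open>Rounding down to multiples of \<open>1 / P\<close> is constant on each cell, so the
  integral is a Riemann sum weighted by the masses of the cells.\<close>

lemma integral_floor_eq_sum:
  fixes F :: "real \<Rightarrow> real"
  assumes P: "P > 0" and F [measurable]: "F \<in> borel_measurable borel"
  shows "(\<integral>x. F (of_int \<lfloor>real P * x\<rfloor> / real P) \<partial>\<nu>) = (\<Sum>k<P. F (real k / real P) * prob (cell P k))"
proof -
  have "(\<integral>x. F (of_int \<lfloor>real P * x\<rfloor> / real P) \<partial>\<nu>) =
      (\<integral>x. (\<Sum>k<P. F (real k / real P) * indicator (cell P k) x) \<partial>\<nu>)"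
  proof (rule integral_cong_AE)
    show "AE x in \<nu>. F (of_int \<lfloor>real P * x\<rfloor> / real P) =
        (\<Sum>k<P. F (real k / real P) * indicator (cell P k) x)"
      using AE_unit
    proof eventually_elim
      case (elim x)
      define i where "i = nat \<lfloor>real P * x\<rfloor>"
      have i: "\<lfloor>real P * x\<rfloor> = int i" "i < P"
        using elim P by (auto simp: i_def nat_less_iff floor_less_iff)
      have "(\<Sum>k<P. F (real k / real P) * indicator (cell P k) x) =
          (\<Sum>k<P. if k = i then F (real k / real P) else 0)"
        using P by (intro sum.cong) (auto simp: mem_cell_iff i(1) indicator_def)
      then show ?case
        using i by simp
    qed
  qed measurable
  also have "\<dots> = (\<Sum>k<P. F (real k / real P) * prob (cell P k))"
  proof -
    have "space \<nu> = UNIV"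
      using sets_eq_imp_space_eq[OF sets_eq] by simp
    moreover have "integrable \<nu> (indicat_real (cell P k))" for k
      by (intro integrable_real_indicator) (auto simp: emeasure_eq_measure)
    ultimately show ?thesis
      by (subst Bochner_Integration.integral_sum) auto
  qed
  finally show ?thesis .
qed

text \<open>The rounding error is at most \<open>1 / p ^ L\<close>, and rounded points of [0,1) stay
  in [0,1], where \<open>F\<close> is bounded; dominated convergence applies.\<close>

lemma integral_floor_tendsto:
  fixes F :: "real \<Rightarrow> real" and p :: nat
  assumes p: "p > 1" and F: "continuous_on UNIV F"
  shows "(\<lambda>L. \<integral>x. F (of_int \<lfloor>real (p ^ L) * x\<rfloor> / real (p ^ L)) \<partial>\<nu>) \<longlonglongrightarrow> (\<integral>x. F x \<partial>\<nu>)"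
proof -
  have [measurable]: "F \<in> borel_measurable borel"
    using F by (rule borel_measurable_continuous_onI)
  have "bounded (F ` {0..1})"
    by (intro compact_imp_bounded compact_continuous_image continuous_on_subset[OF F]) auto
  then obtain B where B: "\<forall>y\<in>F ` {0..1}. norm y \<le> B"
    by (auto simp: bounded_iff)
  have lim: "(\<lambda>L. of_int \<lfloor>real (p ^ L) * x\<rfloor> / real (p ^ L)) \<longlonglongrightarrow> x" for x :: real
  proof (rule LIM_zero_cancel, rule Lim_null_comparison)
    show "\<forall>\<^sub>F L in sequentially.
        norm (of_int \<lfloor>real (p ^ L) * x\<rfloor> / real (p ^ L) - x) \<le> (1 / real p) ^ L"
    proof (intro always_eventually allI)
      fix L
      have "of_int \<lfloor>real (p ^ L) * x\<rfloor> / real (p ^ L) - x = - frac (real (p ^ L) * x) / real (p ^ L)"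
        using p by (simp add: frac_def field_simps)
      then show "norm (of_int \<lfloor>real (p ^ L) * x\<rfloor> / real (p ^ L) - x) \<le> (1 / real p) ^ L"
        using frac_lt_1[of "real (p ^ L) * x"] by (simp add: power_divide divide_right_mono)
    qed
    show "(\<lambda>L. (1 / real p) ^ L) \<longlonglongrightarrow> 0"
      using p by (intro LIMSEQ_realpow_zero) auto
  qed
  show ?thesis
  proof (rule integral_dominated_convergence[where w = "\<lambda>_. B"])
    show "AE x in \<nu>. (\<lambda>L. F (of_int \<lfloor>real (p ^ L) * x\<rfloor> / real (p ^ L))) \<longlonglongrightarrow> F x"
      using F lim by (auto intro!: AE_I2 isCont_tendsto_compose[of _ F] simp: continuous_on_eq_continuous_at)
    show "AE x in \<nu>. norm (F (of_int \<lfloor>real (p ^ L) * x\<rfloor> / real (p ^ L))) \<le> B" for L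
      using AE_unit
    proof eventually_elim
      case (elim x)
      have pL: "real (p ^ L) > 0" using p by simp
      have "of_int \<lfloor>real (p ^ L) * x\<rfloor> \<le> real (p ^ L) * x"
        by (rule of_int_floor_le)
      also have "\<dots> \<le> real (p ^ L)"
        using elim pL by (intro mult_left_le) auto
      finally have "of_int \<lfloor>real (p ^ L) * x\<rfloor> / real (p ^ L) \<in> {0..1}"
        using elim pL by auto
      then show ?case using B by blast
    qed
  qed (auto intro: borel_measurable_integrable)
qed

text \<open>Both sides are limits of Riemann sums, at levels \<open>n + L\<close> and
  \<open>L\<close>, and \<open>cells\<close> compares these term by term. In the application the
  factor \<open>c\<close> is itself an \<open>n\<close>-th power.\<close>

lemma integral_le_preimages:
  fixes F :: "real \<Rightarrow> real" and p n :: nat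
  assumes p: "p > 1" and F: "continuous_on UNIV F" "\<And>x. F x \<ge> 0"
    and cells: "\<And>L k. k < p ^ (n + L) \<Longrightarrow>
      prob (cell (p ^ (n + L)) k) \<le> c * prob (cell (p ^ L) (k mod p ^ L))"
  shows "(\<integral>x. F x \<partial>\<nu>) \<le> c * (\<integral>x. (\<Sum>j<p ^ n. F ((x + real j) / real (p ^ n))) \<partial>\<nu>)"
proof -
  define G where "G x = (\<Sum>j<p ^ n. F ((x + real j) / real (p ^ n)))" for x
  have G: "continuous_on UNIV G"
    unfolding G_def using p
    by (intro continuous_intros continuous_on_compose2[OF F(1)]) auto
  have meas: "F \<in> borel_measurable borel" "G \<in> borel_measurable borel"
    using F G by (auto intro: borel_measurable_continuous_onI)
  have step: "(\<integral>x. F (of_int \<lfloor>real (p ^ (L + n)) * x\<rfloor> / real (p ^ (L + n))) \<partial>\<nu>) \<le>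
      c * (\<integral>x. G (of_int \<lfloor>real (p ^ L) * x\<rfloor> / real (p ^ L)) \<partial>\<nu>)" for L
  proof -
    have "(\<integral>x. F (of_int \<lfloor>real (p ^ (L + n)) * x\<rfloor> / real (p ^ (L + n))) \<partial>\<nu>) =
        (\<Sum>k<p ^ (n + L). F (real k / real (p ^ (n + L))) * prob (cell (p ^ (n + L)) k))"
      using p by (subst integral_floor_eq_sum) (auto simp: meas add.commute)
    also have "\<dots> \<le> (\<Sum>k<p ^ (n + L). F (real k / real (p ^ (n + L))) * (c * prob (cell (p ^ L) (k mod p ^ L))))"
      by (intro sum_mono mult_left_mono cells F) auto
    \<comment> \<open>Writing \<open>k = j * p ^ L + r\<close> separates the \<open>n\<close>
      leading digits \<open>j\<close> from the rest; the left endpoint of cell \<open>k\<close> is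
      then the \<open>j\<close>-th preimage of the left endpoint of cell \<open>r\<close>.\<close>
    also have "\<dots> = (\<Sum>j<p ^ n. \<Sum>r<p ^ L. F (real (j * p ^ L + r) / real (p ^ n * p ^ L)) * (c * prob (cell (p ^ L) r)))"
      by (simp only: power_add sum_lessThan_mult) simp
    also have "\<dots> = (\<Sum>r<p ^ L. \<Sum>j<p ^ n. F (real (j * p ^ L + r) / real (p ^ n * p ^ L)) * (c * prob (cell (p ^ L) r)))"
      by (rule sum.swap)
    also have "\<dots> = c * (\<Sum>r<p ^ L. G (real r / real (p ^ L)) * prob (cell (p ^ L) r))"
    proof -
      have "real (j * p ^ L + r) / real (p ^ n * p ^ L) = (real r / real (p ^ L) + real j) / real (p ^ n)" for j r
        using p by (simp add: field_simps)
      then show ?thesis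
        by (simp only: G_def sum_distrib_left sum_distrib_right mult_ac)
    qed
    also have "\<dots> = c * (\<integral>x. G (of_int \<lfloor>real (p ^ L) * x\<rfloor> / real (p ^ L)) \<partial>\<nu>)"
      using p by (subst integral_floor_eq_sum) (auto simp: meas)
    finally show ?thesis .
  qed
  show ?thesis
  proof (rule LIMSEQ_le)
    show "(\<lambda>L. \<integral>x. F (of_int \<lfloor>real (p ^ (L + n)) * x\<rfloor> / real (p ^ (L + n))) \<partial>\<nu>) \<longlonglongrightarrow> (\<integral>x. F x \<partial>\<nu>)"
      by (rule LIMSEQ_ignore_initial_segment[OF integral_floor_tendsto[OF p F(1)]])
    show "(\<lambda>L. c * (\<integral>x. G (of_int \<lfloor>real (p ^ L) * x\<rfloor> / real (p ^ L)) \<partial>\<nu>)) \<longlonglongrightarrow>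
        c * (\<integral>x. (\<Sum>j<p ^ n. F ((x + real j) / real (p ^ n))) \<partial>\<nu>)"
      using integral_floor_tendsto[OF p G] unfolding G_def by (intro tendsto_intros)
  qed (use step in blast)
qed

end

section \<open>Vanishing of the Fourier coefficients\<close>

context unit_interval_measure
begin

lemma integral_circle_char_power:
  assumes inv: "distr \<nu> borel (\<lambda>x. frac (real q * x)) = \<nu>"
  shows "(\<integral>x. circle_char (m * int q ^ k) x \<partial>\<nu>) = (\<integral>x. circle_char m x \<partial>\<nu>)"
proof (induction k)
  case (Suc k)
  have "(\<integral>x. circle_char (m * int q ^ Suc k) x \<partial>\<nu>) =
      (\<integral>x. circle_char (m * int q ^ k) (frac (real q * x)) \<partial>\<nu>)"
    by (simp add: circle_char_frac mult.left_commute[of m] circle_char_of_int_mult)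
  also have "\<dots> = (\<integral>x. circle_char (m * int q ^ k) x \<partial>distr \<nu> borel (\<lambda>x. frac (real q * x)))"
    by (subst integral_distr) auto
  finally show ?case
    using Suc by (simp add: inv)
qed simp

lemma norm_integral_power2_le:
  fixes f :: "real \<Rightarrow> complex"
  assumes f: "continuous_on UNIV f"
  shows "(norm (\<integral>x. f x \<partial>\<nu>))\<^sup>2 \<le> (\<integral>x. (norm (f x))\<^sup>2 \<partial>\<nu>)"
proof -
  have int: "integrable \<nu> (\<lambda>x. norm (f x))" "integrable \<nu> (\<lambda>x. (norm (f x))\<^sup>2)"
    using f by (auto intro!: integrable_continuous continuous_intros)
  have "(norm (\<integral>x. f x \<partial>\<nu>))\<^sup>2 \<le> (\<integral>x. norm (f x) \<partial>\<nu>)\<^sup>2"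
    by (intro power_mono integral_norm_bound) auto
  \<comment> \<open>This is the nonnegativity of the variance of \<open>norm (f x)\<close>.\<close>
  also have "\<dots> \<le> (\<integral>x. (norm (f x))\<^sup>2 \<partial>\<nu>)"
    using variance_positive[of "\<lambda>x. norm (f x)"] variance_eq[OF int] by simp
  finally show ?thesis .
qed

lemma integral_circle_char_eq_0:
  assumes p: "p > 1" and q: "q > 1" and cop: "coprime p q"
    and inv: "distr \<nu> borel (\<lambda>x. frac (real q * x)) = \<nu>"
    and "0 \<le> c" "c < 1"
    and cells: "\<And>n L k. k < p ^ (n + L) \<Longrightarrow>
      prob (cell (p ^ (n + L)) k) \<le> c ^ n * prob (cell (p ^ L) (k mod p ^ L))"
    and m: "m \<noteq> 0"
  shows "(\<integral>x. circle_char m x \<partial>\<nu>) = 0"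
proof -
  define a where "a = (\<integral>x. circle_char m x \<partial>\<nu>)"
  \<comment> \<open>By Euler's theorem this exponent makes \<open>Q\<close> congruent to 1 modulo
    the square of \<open>p\<close>, hence modulo the square of every prime dividing
    \<open>p ^ n\<close>, as lifting the exponent demands.\<close>
  define s where "s = totient (p\<^sup>2)"
  have s: "s > 0" using p by (simp add: s_def)
  define Q where "Q = int q ^ s"
  have Q1: "Q > 1" using q s by (simp add: Q_def)
  have "[q ^ s = 1] (mod p\<^sup>2)"
    unfolding s_def using cop by (intro euler_theorem) (simp add: coprime_commute)
  then have "[Q = 1] (mod (int p)\<^sup>2)"
    unfolding Q_def by (metis cong_int_iff of_nat_1 of_nat_power)
  then have pQ: "(int p)\<^sup>2 dvd Q - 1"
    by (simp add: cong_iff_dvd_diff)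
  \<comment> \<open>The constant of \<open>card_power_diff_pairs_le\<close>; it does not depend on
    \<open>n\<close>, so the factor \<open>c ^ n\<close> wins in the limit.\<close>
  define K where "K = 2 * nat \<bar>m * (Q - 1)\<bar>"
  have bound: "(norm a)\<^sup>2 \<le> c ^ n * real K" for n
  proof -
    define P where "P = p ^ n"
    have P: "P > 0" using p by (simp add: P_def)
    \<comment> \<open>By \<open>q\<close>-invariance all the averaged characters have the same
      integral \<open>a\<close>, so averaging keeps the integral while making the preimage sums of
      the square small.\<close>
    define f where "f = char_mean P (\<lambda>k. m * Q ^ k)"
    have f: "continuous_on A f" for A
      unfolding f_def by (rule continuous_on_char_mean)
    have "(\<integral>x. f x \<partial>\<nu>) = (\<Sum>k<P. \<integral>x. circle_char (m * Q ^ k) x \<partial>\<nu>) / of_nat P"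
      unfolding f_def char_mean_def
      by (subst Bochner_Integration.integral_sum[symmetric])
        (auto intro!: integrable_continuous continuous_intros)
    also have "\<dots> = a"
      using P integral_circle_char_power[OF inv]
      by (simp add: a_def Q_def flip: power_mult)
    finally have "(norm a)\<^sup>2 \<le> (\<integral>x. (norm (f x))\<^sup>2 \<partial>\<nu>)"
      using norm_integral_power2_le[OF f] by simp
    also have "\<dots> \<le> c ^ n * (\<integral>x. (\<Sum>j<p ^ n. (norm (f ((x + real j) / real (p ^ n))))\<^sup>2) \<partial>\<nu>)"
      using cells by (intro integral_le_preimages p) (auto intro!: continuous_intros f)
    also have "\<dots> \<le> c ^ n * (\<integral>x. real K \<partial>\<nu>)"
    proof (intro mult_left_mono integral_mono)
      fix x
      have "card {(l, k). l < P \<and> k < P \<and> int P dvd m * Q ^ k - m * Q ^ l} \<le> P * K"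
      proof -
        have "coprime (int P) Q"
          using cop by (simp add: P_def Q_def)
        moreover have "r\<^sup>2 dvd Q - 1" if "prime r" "r dvd int P" for r :: int
          using that pQ unfolding P_def
          by (metis dvd_power_same dvd_trans of_nat_power prime_dvd_power)
        ultimately have "card {(l, k). l < P \<and> k < P \<and> int P dvd m * (Q ^ k - Q ^ l)} \<le> P * K"
          unfolding K_def using P m Q1 by (intro card_power_diff_pairs_le) auto
        then show ?thesis by (simp add: right_diff_distrib)
      qed
      then have "real (card {(l, k). l < P \<and> k < P \<and> int P dvd m * Q ^ k - m * Q ^ l}) / real P \<le> real K"
        using P by (simp add: field_simps flip: of_nat_mult)
      then show "(\<Sum>j<p ^ n. (norm (f ((x + real j) / real (p ^ n))))\<^sup>2) \<le> real K"
        using sum_preimages_char_mean[OF P, of "\<lambda>k. m * Q ^ k" x] by (simp add: f_def P_def)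
    qed (use p \<open>0 \<le> c\<close> in \<open>auto intro!: integrable_continuous continuous_intros continuous_on_compose2[OF f]\<close>)
    finally show ?thesis by (simp add: prob_space)
  qed
  have "(\<lambda>n. c ^ n * real K) \<longlonglongrightarrow> 0 * real K"
    using \<open>0 \<le> c\<close> \<open>c < 1\<close> by (intro tendsto_intros LIMSEQ_realpow_zero)
  then have "(norm a)\<^sup>2 \<le> 0"
    using bound by (intro LIMSEQ_le_const) auto
  then show ?thesis by (simp add: a_def)
qed

end

section \<open>Fourier uniqueness\<close>

text \<open>Trigonometric polynomials are generated inductively rather than given by coefficient
  families, so closure under products and equality of integrals are plain inductions.\<close>

inductive trig_poly :: "(real \<Rightarrow> complex) \<Rightarrow> bool" where
  monom: "trig_poly (\<lambda>x. c * circle_char k x)"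
| add: "trig_poly f \<Longrightarrow> trig_poly g \<Longrightarrow> trig_poly (\<lambda>x. f x + g x)"

lemma trig_poly_const: "trig_poly (\<lambda>x. c)"
  using trig_poly.monom[of c 0] by simp

lemma trig_poly_mult:
  assumes "trig_poly f" "trig_poly g"
  shows "trig_poly (\<lambda>x. f x * g x)"
  using assms(1)
proof induction
  case (monom c k)
  from assms(2) show ?case
  proof induction
    case (monom d l)
    have "(\<lambda>x. c * circle_char k x * (d * circle_char l x)) = (\<lambda>x. (c * d) * circle_char (k + l) x)"
      by (simp add: circle_char_mult[symmetric] mult_ac)
    then show ?case by (simp only: trig_poly.monom)
  qed (simp add: distrib_left trig_poly.add)
qed (simp add: distrib_right trig_poly.add)

lemma trig_poly_real_polynomial_function:
  fixes g :: "complex \<Rightarrow> real"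
  assumes "real_polynomial_function g"
  shows "trig_poly (\<lambda>x. complex_of_real (g (circle_char 1 x)))"
  using assms
proof induction
  case (linear f)
  then interpret bounded_linear f .
  \<comment> \<open>A real-linear \<open>f\<close> is determined by its values at 1 and
    \<open>\<i>\<close>; the coefficients come from expressing real and imaginary parts through
    \<open>w\<close> and its conjugate, the character of frequency -1.\<close>
  have "complex_of_real (f (circle_char 1 x)) =
      (of_real (f 1) / 2 - of_real (f \<i>) * \<i> / 2) * circle_char 1 x +
      (of_real (f 1) / 2 + of_real (f \<i>) * \<i> / 2) * circle_char (- 1) x" for x
  proof -
    let ?w = "circle_char 1 x"
    have "?w = Re ?w *\<^sub>R 1 + Im ?w *\<^sub>R \<i>"
      by (simp add: complex_eq_iff)
    then have "f ?w = Re ?w * f 1 + Im ?w * f \<i>"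
      by (metis add scaleR real_scaleR_def)
    moreover have "circle_char (- 1) x = cnj ?w"
      by (simp add: cnj_circle_char)
    ultimately show ?thesis
      by (simp add: complex_eq_iff field_simps)
  qed
  then show ?case
    by (simp only: trig_poly.intros)
qed (simp_all add: trig_poly_const trig_poly_mult trig_poly.add)

text \<open>\<open>Arg2pi\<close> jumps across the positive real axis, but its sublevel sets are
  closed.\<close>

lemma borel_measurable_Arg2pi [measurable]: "Arg2pi \<in> borel_measurable borel"
  unfolding borel_measurable_iff_le using closed_Arg2pi2pi_le by (auto intro: borel_closed)

context unit_interval_measure
begin

text \<open>Equality spreads from characters to trigonometric polynomials, by Stone-Weierstrass to
  continuous functions on the unit circle, then to open sets and to all Borel sets. Frequency 0 is
  automatic for probability measures.\<close>

lemma eqI_integral_circle_char: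
  assumes \<nu>': "unit_interval_measure \<nu>'"
    and eq: "\<And>m. m \<noteq> 0 \<Longrightarrow> (\<integral>x. circle_char m x \<partial>\<nu>) = (\<integral>x. circle_char m x \<partial>\<nu>')"
  shows "\<nu> = \<nu>'"
proof -
  interpret \<nu>': unit_interval_measure \<nu>' by fact
  have trig: "integrable \<nu> f \<and> integrable \<nu>' f \<and> (\<integral>x. f x \<partial>\<nu>) = (\<integral>x. f x \<partial>\<nu>')" if "trig_poly f" for f
    using that
  proof induction
    case (monom c k)
    have "integrable \<nu> (circle_char k)" "integrable \<nu>' (circle_char k)"
      by (auto intro!: integrable_continuous \<nu>'.integrable_continuous continuous_intros)
    moreover have "(\<integral>x. circle_char k x \<partial>\<nu>) = (\<integral>x. circle_char k x \<partial>\<nu>')"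
      using eq by (cases "k = 0") (simp_all add: prob_space \<nu>'.prob_space)
    ultimately show ?case by simp
  qed auto
  have cont: "(\<integral>x. g (circle_char 1 x) \<partial>\<nu>) = (\<integral>x. g (circle_char 1 x) \<partial>\<nu>')"
    if g: "continuous_on UNIV g" for g :: "complex \<Rightarrow> real"
  proof -
    have int: "integrable \<nu> (\<lambda>x. f (circle_char 1 x))" "integrable \<nu>' (\<lambda>x. f (circle_char 1 x))"
      if "continuous_on UNIV f" for f :: "complex \<Rightarrow> real"
      by (auto intro!: integrable_continuous \<nu>'.integrable_continuous continuous_intros
        continuous_on_compose2[OF that])
    have "\<bar>(\<integral>x. g (circle_char 1 x) \<partial>\<nu>) - (\<integral>x. g (circle_char 1 x) \<partial>\<nu>')\<bar> \<le> 0 + e" if "e > 0" for e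
    proof -
      obtain h where h: "real_polynomial_function h" "\<And>z. z \<in> sphere 0 1 \<Longrightarrow> \<bar>g z - h z\<bar> < e / 2"
        using Stone_Weierstrass_real_polynomial_function[of "sphere 0 1" g "e / 2"]
          continuous_on_subset[OF g] \<open>e > 0\<close> by auto
      have hc: "continuous_on UNIV h"
        using h(1) continuous_on_polymonial_function real_polynomial_function_eq by blast
      have heq: "(\<integral>x. h (circle_char 1 x) \<partial>\<nu>) = (\<integral>x. h (circle_char 1 x) \<partial>\<nu>')"
        using trig[OF trig_poly_real_polynomial_function[OF h(1)]] by simp
      have close: "\<bar>g (circle_char 1 x) - h (circle_char 1 x)\<bar> \<le> e / 2" for x
        using h(2)[of "circle_char 1 x"] by simp
      have "\<bar>(\<integral>x. g (circle_char 1 x) \<partial>\<nu>) - (\<integral>x. h (circle_char 1 x) \<partial>\<nu>)\<bar> =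
          \<bar>\<integral>x. g (circle_char 1 x) - h (circle_char 1 x) \<partial>\<nu>\<bar>"
        using int g hc by simp
      also have "\<dots> \<le> (\<integral>x. \<bar>g (circle_char 1 x) - h (circle_char 1 x)\<bar> \<partial>\<nu>)"
        by (rule integral_abs_bound)
      also have "\<dots> \<le> (\<integral>x. e / 2 \<partial>\<nu>)"
        using int g hc close by (intro integral_mono) auto
      finally have 1: "\<bar>(\<integral>x. g (circle_char 1 x) \<partial>\<nu>) - (\<integral>x. h (circle_char 1 x) \<partial>\<nu>)\<bar> \<le> e / 2"
        by (simp add: prob_space)
      have "\<bar>(\<integral>x. g (circle_char 1 x) \<partial>\<nu>') - (\<integral>x. h (circle_char 1 x) \<partial>\<nu>')\<bar> =
          \<bar>\<integral>x. g (circle_char 1 x) - h (circle_char 1 x) \<partial>\<nu>'\<bar>"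
        using int g hc by simp
      also have "\<dots> \<le> (\<integral>x. \<bar>g (circle_char 1 x) - h (circle_char 1 x)\<bar> \<partial>\<nu>')"
        by (rule integral_abs_bound)
      also have "\<dots> \<le> (\<integral>x. e / 2 \<partial>\<nu>')"
        using int g hc close by (intro integral_mono) auto
      finally have "\<bar>(\<integral>x. g (circle_char 1 x) \<partial>\<nu>') - (\<integral>x. h (circle_char 1 x) \<partial>\<nu>')\<bar> \<le> e / 2"
        by (simp add: \<nu>'.prob_space)
      with 1 heq show ?thesis by linarith
    qed
    then have "\<bar>(\<integral>x. g (circle_char 1 x) \<partial>\<nu>) - (\<integral>x. g (circle_char 1 x) \<partial>\<nu>')\<bar> \<le> 0"
      by (rule field_le_epsilon)
    then show ?thesis by simp
  qed
  have open_eq: "measure \<nu> (circle_char 1 -` U) = measure \<nu>' (circle_char 1 -` U)" if U: "open U" for U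
  proof -
    \<comment> \<open>These functions converge pointwise to the indicator of \<open>U\<close>. The
      whole plane is excluded because \<open>infdist\<close> to the empty set is 0 by
      convention.\<close>
    define g where "g n z = min 1 (real n * infdist z (- U))" for n z
    have g: "continuous_on UNIV (g n)" for n
      unfolding g_def by (intro continuous_intros)
    have lim: "(\<lambda>n. g n z) \<longlonglongrightarrow> indicator U z" if "U \<noteq> UNIV" for z
    proof (cases "z \<in> U")
      case False
      then show ?thesis by (simp add: g_def)
    next
      case True
      then have pos: "infdist z (- U) > 0"
        using U that infdist_pos_not_in_closed[of "- U" z] by (auto simp: open_closed)
      obtain N where N: "1 / infdist z (- U) \<le> real N"
        using real_arch_simple by blast
      have "g n z = 1" if "n \<ge> N" for n
        using N that pos unfolding g_def by (auto simp: field_simps min_def intro: order.trans mult_left_mono)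
      then show ?thesis
        using True by (intro tendsto_eventually) (auto simp: eventually_sequentially)
    qed
    have gb: "norm (g n z) \<le> 1" for n z
      by (auto simp: g_def infdist_nonneg)
    have *: "(\<lambda>n. \<integral>x. g n (circle_char 1 x) \<partial>M) \<longlonglongrightarrow> measure M (circle_char 1 -` U)"
      if "U \<noteq> UNIV" and M: "unit_interval_measure M" for M
    proof -
      interpret M: unit_interval_measure M by fact
      have sp: "space M = UNIV"
        using sets_eq_imp_space_eq[OF M.sets_eq] by simp
      have [measurable]: "U \<in> sets borel" "g n \<in> borel_measurable borel" for n
        using U g by (auto intro: borel_measurable_continuous_onI)
      have "(\<lambda>n. \<integral>x. g n (circle_char 1 x) \<partial>M) \<longlonglongrightarrow> (\<integral>x. indicator U (circle_char 1 x) \<partial>M)"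
        by (rule integral_dominated_convergence[where w = "\<lambda>_. 1"])
          (use lim[OF \<open>U \<noteq> UNIV\<close>] gb in \<open>auto intro!: AE_I2\<close>)
      also have "(\<integral>x. indicator U (circle_char 1 x) \<partial>M) = (\<integral>x. indicator (circle_char 1 -` U) x \<partial>M)"
        by (simp add: indicator_def)
      also have "\<dots> = measure M (circle_char 1 -` U)"
        by (simp add: sp)
      finally show ?thesis .
    qed
    show ?thesis
    proof (cases "U = UNIV")
      case True
      then show ?thesis
        using prob_space \<nu>'.prob_space sets_eq_imp_space_eq[OF sets_eq]
          sets_eq_imp_space_eq[OF \<nu>'.sets_eq] by simp
    next
      case False
      show ?thesis
        using *[OF False unit_interval_measure_axioms] *[OF False \<nu>'] cont[OF g]
        by (simp add: LIMSEQ_unique)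
    qed
  qed
  have distr_eq: "distr \<nu> borel (circle_char 1) = distr \<nu>' borel (circle_char 1)"
  proof (rule measure_eqI_generator_eq[where E = "{S. open S}" and \<Omega> = UNIV and A = "\<lambda>_. UNIV"])
    show "emeasure (distr \<nu> borel (circle_char 1)) X = emeasure (distr \<nu>' borel (circle_char 1)) X"
      if "X \<in> {S. open S}" for X
      using that open_eq[of X] sets_eq_imp_space_eq[OF sets_eq] sets_eq_imp_space_eq[OF \<nu>'.sets_eq]
      by (simp add: emeasure_distr emeasure_eq_measure \<nu>'.emeasure_eq_measure)
    show "emeasure (distr \<nu> borel (circle_char 1)) UNIV \<noteq> \<infinity>"
      by (simp add: emeasure_distr emeasure_eq_measure)
  qed (auto simp: Int_stable_def borel_def)
  \<comment> \<open>On [0,1) the map \<open>circle_char 1\<close> has the Borel left inverse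
    \<open>Arg2pi w / (2 * pi)\<close>, so its image measure determines the original
    measure.\<close>
  have recover: "M = distr (distr M borel (circle_char 1)) borel (\<lambda>w. Arg2pi w / (2 * pi))"
    if "unit_interval_measure M" for M
  proof -
    interpret M: unit_interval_measure M by fact
    have "M = distr M borel (\<lambda>x. x)"
      by (rule distr_id2[symmetric]) simp
    also have "\<dots> = distr M borel (\<lambda>x. Arg2pi (circle_char 1 x) / (2 * pi))"
    proof (rule distr_cong_AE)
      show "AE x in M. x = Arg2pi (circle_char 1 x) / (2 * pi)"
        using M.AE_unit
      proof eventually_elim
        case (elim x)
        have "Arg2pi (circle_char 1 x) = 2 * pi * x"
          by (rule Arg2pi_unique[of 1]) (use elim in \<open>auto simp: circle_char_def cis_conv_exp\<close>)
        then show ?case by simp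
      qed
    qed auto
    also have "\<dots> = distr (distr M borel (circle_char 1)) borel (\<lambda>w. Arg2pi w / (2 * pi))"
      by (subst distr_distr) (auto simp: o_def)
    finally show ?thesis .
  qed
  show ?thesis
    using recover[OF unit_interval_measure_axioms] recover[OF \<nu>'] distr_eq by simp
qed

end

section \<open>Lebesgue measure on the unit interval and its Fourier coefficients\<close>

lemma unit_interval_measure_lborel:
  "unit_interval_measure (distr (restrict_space lborel {0..<1}) borel (\<lambda>x. x))" (is "unit_interval_measure ?N")
proof (intro unit_interval_measure.intro unit_interval_measure_axioms.intro prob_spaceI)
  have meas: "(\<lambda>x. x) \<in> measurable (restrict_space lborel {0..<1::real}) borel"
    by (rule measurable_restrict_space1) simp
  show "emeasure ?N (space ?N) = 1"
    using meas by (simp add: emeasure_distr space_restrict_space emeasure_restrict_space)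
  show "AE x in ?N. 0 \<le> x \<and> x < 1"
    using meas by (subst AE_distr_iff) (auto simp: space_restrict_space intro!: AE_I2)
qed simp

lemma integral_circle_char_lborel:
  assumes "m \<noteq> 0"
  shows "(\<integral>x. circle_char m x \<partial>distr (restrict_space lborel {0..<1}) borel (\<lambda>x. x)) = 0"
proof -
  have meas: "(\<lambda>x. x) \<in> measurable (restrict_space lborel {0..<1::real}) borel"
    by (rule measurable_restrict_space1) simp
  let ?c = "2 * pi * of_int m :: real"
  let ?F = "\<lambda>x. circle_char m x / (\<i> * of_real ?c)"
  have c: "?c \<noteq> 0" using assms by simp
  have "(\<integral>x. circle_char m x \<partial>distr (restrict_space lborel {0..<1}) borel (\<lambda>x. x)) =
      (\<integral>x. indicator {0..<1} x *\<^sub>R circle_char m x \<partial>lborel)"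
    using meas by (simp add: integral_distr integral_restrict_space)
  \<comment> \<open>Adding the null point 1 gives a compact interval for the fundamental theorem;
    the primitive \<open>?F\<close> has period 1, so its boundary values cancel.\<close>
  also have "\<dots> = (\<integral>x. indicator {0..1} x *\<^sub>R circle_char m x \<partial>lborel)"
  proof (rule integral_cong_AE)
    show "AE x in lborel. indicator {0..<1} x *\<^sub>R circle_char m x = indicator {0..1} x *\<^sub>R circle_char m x"
      using AE_lborel_singleton[of "1::real"] by eventually_elim (auto simp: indicator_def)
  qed auto
  also have "\<dots> = ?F 1 - ?F 0"
  proof (rule integral_FTC_Icc)
    fix x :: real
    show "(?F has_vector_derivative circle_char m x) (at x within {0..1})"
    proof -
      let ?G = "\<lambda>z. exp (\<i> * of_real ?c * z)"
      have eq: "circle_char m y = ?G (of_real y)" for y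
        by (simp add: circle_char_def cis_conv_exp mult_ac)
      have "((\<lambda>z. ?G z / (\<i> * of_real ?c)) has_field_derivative ?G (of_real x)) (at (of_real x))"
        using c by (auto intro!: derivative_eq_intros)
      then show ?thesis
        unfolding eq by (rule has_vector_derivative_real_field)
    qed
  qed (auto intro!: continuous_intros)
  also have "\<dots> = 0"
    using circle_char_add_int[of 1 m 0] by simp
  finally show ?thesis .
qed

section \<open>Coordinates and cylinders on the circle\<close>

lift_definition circle_embedding :: "circle \<Rightarrow> complex" is "circle_char 1"
  by (metis circle_char_add_int add.commute diff_add_cancel)

lemma borel_measurable_circle_embedding [measurable]: "circle_embedding \<in> borel_measurable borel"
proof (rule borel_measurable_continuous_onI)
  have "to_circle -` (circle_embedding -` U) = circle_char 1 -` U" for U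
    by (auto simp: circle_embedding.abs_eq)
  then show "continuous_on UNIV circle_embedding"
    by (auto simp: continuous_on_open_vimage open_circle_def intro!: open_vimage continuous_intros)
qed

text \<open>\<open>rep_circle\<close> picks an unspecified representative. Going through the complex
  argument gives the one in [0,1) and makes the choice Borel measurable.\<close>

definition circle_coord :: "circle \<Rightarrow> real" where
  "circle_coord z = Arg2pi (circle_embedding z) / (2 * pi)"

lemma borel_measurable_circle_coord [measurable]: "circle_coord \<in> borel_measurable borel"
  unfolding circle_coord_def[abs_def] by measurable

lemma circle_coord_to_circle: "circle_coord (to_circle x) = frac x"
proof -
  have "Arg2pi (circle_char 1 (frac x)) = 2 * pi * frac x"
    by (rule Arg2pi_unique[of 1]) (auto simp: circle_char_def cis_conv_exp frac_lt_1)
  then show ?thesis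
    by (simp add: circle_coord_def circle_embedding.abs_eq circle_char_frac)
qed

lemma to_circle_frac: "to_circle (frac x) = to_circle x"
  by (simp add: to_circle_eq_iff frac_def)

lemma to_circle_circle_coord [simp]: "to_circle (circle_coord z) = z"
  by (metis Quotient3_abs_rep[OF Quotient3_circle] circle_coord_to_circle to_circle_frac)

lemma circle_coord_bounds: "0 \<le> circle_coord z" "circle_coord z < 1"
  by (metis circle_coord_to_circle frac_ge_0 frac_lt_1 to_circle_circle_coord)+

lemma circle_coord_times_map: "circle_coord (times_map p z) = frac (real p * circle_coord z)"
  by (metis circle_coord_to_circle times_map.abs_eq to_circle_circle_coord)

text \<open>The floor of \<open>p * P * x\<close> is \<open>P\<close> times the floor of
  \<open>p * x\<close> plus a remainder below \<open>P\<close> read off from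
  \<open>frac (p * x)\<close>; uniqueness of division with remainder separates the leading digit
  \<open>j\<close> from \<open>v\<close>.\<close>

lemma mem_cell_append_digit_iff:
  assumes p: "p > 0" and "v < P"
  shows "x \<in> cell (p * P) (j * P + v) \<longleftrightarrow> \<lfloor>real p * x\<rfloor> = int j \<and> frac (real p * x) \<in> cell P v"
proof -
  have P: "P > 0" using assms by simp
  define i where "i = \<lfloor>real p * x\<rfloor>"
  define t where "t = \<lfloor>real P * frac (real p * x)\<rfloor>"
  have "0 \<le> t" "t < int P"
    using P frac_lt_1[of "real p * x"] by (auto simp: t_def floor_less_iff)
  have "real (p * P) * x = of_int (i * int P) + real P * frac (real p * x)"
    by (simp add: i_def frac_def algebra_simps)
  then have eq: "\<lfloor>real (p * P) * x\<rfloor> = i * int P + t"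
    by (simp only: t_def int_add_floor)
  have "i * int P + t = int (j * P + v) \<longleftrightarrow> i = int j \<and> t = int v"
  proof
    assume *: "i * int P + t = int (j * P + v)"
    then have "(i * int P + t) div int P = (int j * int P + int v) div int P"
      by simp
    then have "i = int j"
      using \<open>0 \<le> t\<close> \<open>t < int P\<close> assms by simp
    with * show "i = int j \<and> t = int v" by simp
  qed simp
  then show ?thesis
    using P p by (simp add: mem_cell_iff eq flip: i_def t_def del: of_nat_mult)
qed

text \<open>Closed arc and half-open cell can differ only in the right endpoint, which a non-atomic
  measure ignores. It is named as a point of the circle because its coordinate wraps to 0 when
  \<open>i = p - 1\<close>.\<close>

lemma arc_eq:
  assumes i: "i < p"
  shows "arc p i = circle_coord -` cell p i \<union> {to_circle ((real i + 1) / real p)}"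
proof (intro equalityI subsetI)
  fix z assume z: "z \<in> arc p i"
  show "z \<in> circle_coord -` cell p i \<union> {to_circle ((real i + 1) / real p)}"
  proof (cases "z = to_circle ((real i + 1) / real p)")
    case False
    with z obtain y where y: "z = to_circle y" "real i / real p \<le> y" "y < (real i + 1) / real p"
      by (force simp: arc_def)
    have "(real i + 1) / real p \<le> 1"
      using i by (simp add: field_simps)
    with y have "frac y = y"
      by (subst frac_eq) (auto intro: order.trans[OF _ y(2)])
    with y show ?thesis
      by (simp add: circle_coord_to_circle cell_def)
  qed simp
next
  fix z assume "z \<in> circle_coord -` cell p i \<union> {to_circle ((real i + 1) / real p)}"
  then consider "circle_coord z \<in> cell p i" | "z = to_circle ((real i + 1) / real p)"
    by blast
  then show "z \<in> arc p i"
  proof cases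
    case 1
    then show ?thesis
      unfolding arc_def cell_def by (intro image_eqI[of _ _ "circle_coord z"]) auto
  next
    case 2
    then show ?thesis
      unfolding arc_def by (auto simp: divide_right_mono)
  qed
qed

section \<open>Words, cylinders and base \<open>p\<close> digits\<close>

lemma cylinder_Nil: "cylinder p [] = UNIV"
  by (simp add: cylinder_def)

lemma cylinder_Cons: "cylinder p (i # w) = arc p i \<inter> times_map p -` cylinder p w"
proof -
  have "{..<length (i # w)} = insert 0 (Suc ` {..<length w})"
    by (simp add: lessThan_Suc_eq_insert_0)
  then show ?thesis
    unfolding cylinder_def by (auto simp: funpow_swap1)
qed

fun word_value :: "nat \<Rightarrow> nat list \<Rightarrow> nat" where
  "word_value p [] = 0"
| "word_value p (i # w) = i * p ^ length w + word_value p w"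

lemma word_value_less: "set w \<subseteq> {..<p} \<Longrightarrow> word_value p w < p ^ length w"
proof (induction w)
  case (Cons i w)
  then have "word_value p (i # w) < (i + 1) * p ^ length w"
    by simp
  also have "\<dots> \<le> p * p ^ length w"
    using Cons by (intro mult_right_mono) auto
  finally show ?case by simp
qed simp

lemma ex_word_value: "k < p ^ n \<Longrightarrow> \<exists>w\<in>words p n. word_value p w = k"
proof (induction n arbitrary: k)
  case 0
  then show ?case by (simp add: words_def)
next
  case (Suc n)
  then have "p > 0" by (cases p) auto
  then have "k mod p ^ n < p ^ n" by simp
  from Suc.IH[OF this] obtain w where w: "w \<in> words p n" "word_value p w = k mod p ^ n"
    by blast
  moreover have "k div p ^ n < p"
    using Suc.prems by (simp add: less_mult_imp_div_less)
  ultimately show ?case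
    by (intro bexI[of _ "(k div p ^ n) # w"]) (auto simp: words_def div_mult_mod_eq)
qed

lemma finite_words: "finite (words p n)"
  by (rule finite_subset[OF _ finite_lists_length_eq[of "{..<p}" n]]) (auto simp: words_def)

section \<open>Non-atomic circle measures in coordinates\<close>

locale nonatomic_circle_measure = prob_space \<mu> for \<mu> :: "circle measure" +
  assumes sets_eq [measurable_cong, simp]: "sets \<mu> = sets borel"
    and nonatomic: "emeasure \<mu> {x} = 0"
begin

lemma space_eq [simp]: "space \<mu> = UNIV"
  using sets_eq_imp_space_eq[OF sets_eq] by simp

abbreviation coord_measure :: "real measure" where
  "coord_measure \<equiv> distr \<mu> borel circle_coord"

sublocale coord: unit_interval_measure coord_measure
proof (intro unit_interval_measure.intro unit_interval_measure_axioms.intro)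
  show "prob_space coord_measure"
    by (rule prob_space_distr) measurable
  show "AE x in coord_measure. 0 \<le> x \<and> x < 1"
    by (subst AE_distr_iff) (auto simp: circle_coord_bounds intro!: AE_I2)
qed (rule sets_distr)

lemma distr_coord_measure_to_circle: "distr coord_measure borel to_circle = \<mu>"
proof -
  have "distr coord_measure borel to_circle = distr \<mu> borel (to_circle \<circ> circle_coord)"
    by (rule distr_distr) measurable
  also have "to_circle \<circ> circle_coord = (\<lambda>z. z)"
    by (simp add: o_def)
  also have "distr \<mu> borel (\<lambda>z. z) = \<mu>"
    by (rule distr_id2) (rule sets_eq[symmetric])
  finally show ?thesis .
qed

lemma distr_times_map:
  assumes "times_invariant p \<mu>"
  shows "distr \<mu> borel (times_map p) = \<mu>"
  using assms by (intro measure_eqI) (auto simp: emeasure_distr times_invariant_def)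

lemma distr_coord_measure_frac:
  assumes "times_invariant p \<mu>"
  shows "distr coord_measure borel (\<lambda>x. frac (real p * x)) = coord_measure"
proof -
  have "distr coord_measure borel (\<lambda>x. frac (real p * x)) =
      distr \<mu> borel ((\<lambda>x. frac (real p * x)) \<circ> circle_coord)"
    by (rule distr_distr) measurable
  also have "\<dots> = distr \<mu> borel (circle_coord \<circ> times_map p)"
    by (simp add: o_def circle_coord_times_map)
  also have "\<dots> = distr (distr \<mu> borel (times_map p)) borel circle_coord"
    by (rule distr_distr[symmetric]) measurable
  finally have "distr coord_measure borel (\<lambda>x. frac (real p * x)) =
      distr (distr \<mu> borel (times_map p)) borel circle_coord" .
  then show ?thesis
    by (simp only: distr_times_map[OF assms])
qed

lemma AE_mem_cylinder_iff:
  assumes p: "p > 0" "times_invariant p \<mu>" and w: "set w \<subseteq> {..<p}"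
  shows "cylinder p w \<in> sets borel \<and>
    (AE z in \<mu>. z \<in> cylinder p w \<longleftrightarrow> circle_coord z \<in> cell (p ^ length w) (word_value p w))"
  using w
proof (induction w)
  case Nil
  then show ?case
    by (auto simp: cylinder_Nil cell_def circle_coord_bounds)
next
  case (Cons i w)
  then have i: "i < p" and IH: "cylinder p w \<in> sets borel"
    "AE z in \<mu>. z \<in> cylinder p w \<longleftrightarrow> circle_coord z \<in> cell (p ^ length w) (word_value p w)"
    by auto
  have arc: "arc p i \<in> sets borel"
    unfolding arc_eq[OF i] using measurable_sets[OF borel_measurable_circle_coord cell_borel, of p i]
    by (auto intro!: sets.Un)
  have meas: "cylinder p (i # w) \<in> sets borel"
    unfolding cylinder_Cons using arc measurable_sets[OF measurable_times_map IH(1), of p] by auto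
  \<comment> \<open>The exceptional set for \<open>w\<close> is pulled back along
    \<open>times_map p\<close>; invariance keeps it null.\<close>
  have "AE z in distr \<mu> borel (times_map p).
      z \<in> cylinder p w \<longleftrightarrow> circle_coord z \<in> cell (p ^ length w) (word_value p w)"
    using IH(2) by (simp only: distr_times_map[OF p(2)])
  then have ev: "AE z in \<mu>. times_map p z \<in> cylinder p w \<longleftrightarrow>
      circle_coord (times_map p z) \<in> cell (p ^ length w) (word_value p w)"
    by (rule AE_distrD[rotated]) measurable
  have "{to_circle ((real i + 1) / real p)} \<in> null_sets \<mu>"
    using nonatomic by (auto simp: null_sets_def)
  then have "AE z in \<mu>. z \<noteq> to_circle ((real i + 1) / real p)"
    using AE_not_in by fastforce
  with ev have "AE z in \<mu>. z \<in> cylinder p (i # w) \<longleftrightarrow>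
      circle_coord z \<in> cell (p ^ length (i # w)) (word_value p (i # w))"
  proof eventually_elim
    case (elim z)
    then show ?case
      using word_value_less[of w p] Cons.prems p
      by (simp add: cylinder_Cons arc_eq[OF i] mem_cell_append_digit_iff circle_coord_times_map mem_cell_iff[of p _ i])
  qed
  with meas show ?case by blast
qed

lemma emeasure_cylinder:
  assumes "p > 0" "times_invariant p \<mu>" "set w \<subseteq> {..<p}"
  shows "emeasure \<mu> (cylinder p w) = ennreal (coord.prob (cell (p ^ length w) (word_value p w)))"
proof -
  have "circle_coord -` cell P k \<in> sets borel" for P k
    using measurable_sets[OF borel_measurable_circle_coord cell_borel] by simp
  then have "emeasure \<mu> (cylinder p w) = emeasure \<mu> (circle_coord -` cell (p ^ length w) (word_value p w))"
    using AE_mem_cylinder_iff[OF assms] by (intro emeasure_eq_AE) auto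
  then show ?thesis
    by (simp add: emeasure_distr flip: coord.emeasure_eq_measure)
qed

text \<open>The preimage of a cell consists of the cells obtained by prepending any leading digit,
  and these are disjoint. Only points of [0,1) have a leading digit below \<open>p\<close>, so the
  decomposition holds almost everywhere.\<close>

lemma sum_prob_cell_preimages:
  assumes p: "p > 0" "times_invariant p \<mu>" and v: "v < P"
  shows "(\<Sum>j<p. coord.prob (cell (p * P) (j * P + v))) = coord.prob (cell P v)"
proof -
  let ?f = "\<lambda>x. frac (real p * x)"
  have P: "P > 0" using v by simp
  have "coord.prob (cell P v) = measure (distr coord_measure borel ?f) (cell P v)"
    by (simp add: distr_coord_measure_frac[OF p(2)])
  also have "\<dots> = coord.prob (?f -` cell P v)"
    by (subst measure_distr) auto
  also have "\<dots> = coord.prob (\<Union>j<p. cell (p * P) (j * P + v))"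
  proof (rule measure_eq_AE)
    show "AE x in coord_measure. x \<in> ?f -` cell P v \<longleftrightarrow> x \<in> (\<Union>j<p. cell (p * P) (j * P + v))"
      using coord.AE_unit
    proof eventually_elim
      case (elim x)
      have "0 \<le> \<lfloor>real p * x\<rfloor>" "\<lfloor>real p * x\<rfloor> < int p"
        using elim p by (auto simp: floor_less_iff)
      then have "\<exists>j<p. \<lfloor>real p * x\<rfloor> = int j"
        by (metis nat_less_iff int_nat_eq)
      then show ?case
        by (auto simp: mem_cell_append_digit_iff[OF p(1) v])
    qed
    have "?f \<in> borel_measurable borel" by measurable
    then have "?f -` cell P v \<inter> space borel \<in> sets borel"
      using cell_borel by (rule measurable_sets)
    then show "?f -` cell P v \<in> sets coord_measure" by simp
  qed auto
  also have "\<dots> = (\<Sum>j<p. coord.prob (cell (p * P) (j * P + v)))"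
  proof (rule coord.finite_measure_finite_Union)
    show "disjoint_family_on (\<lambda>j. cell (p * P) (j * P + v)) {..<p}"
      by (auto simp: disjoint_family_on_def mem_cell_append_digit_iff[OF p(1) v])
  qed auto
  finally show ?thesis by simp
qed

section \<open>From balanced geometry to Lebesgue measure\<close>

lemma balanced_geometry_imp_cell_bound:
  assumes p: "p > 1" "times_invariant p \<mu>" and "balanced_geometry p \<mu>"
  obtains c where "0 \<le> c" "c < 1"
    "\<And>n i v. i < p \<Longrightarrow> v < p ^ n \<Longrightarrow>
      coord.prob (cell (p ^ Suc n) (i * p ^ n + v)) \<le> c * coord.prob (cell (p ^ n) v)"
proof -
  obtain C :: real where C: "C > 0" "\<And>n. balance p \<mu> n \<ge> ennreal C"
    using assms(3) unfolding balanced_geometry_def by (metis diff_Suc_1 le_add1 plus_1_eq_Suc)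
  show ?thesis
  proof (rule that)
    \<comment> \<open>Balance bounds \<open>C\<close> times the mass of one child by the mass of its
      siblings. Adding the child itself yields, by invariance, \<open>1 + C\<close> times its mass
      at most that of the cell of \<open>w\<close>.\<close>
    show "0 \<le> 1 / (1 + C)" "1 / (1 + C) < 1"
      using C by auto
    fix n i v assume i: "i < p" and v: "v < p ^ n"
    obtain w where w: "w \<in> words p n" "word_value p w = v"
      using ex_word_value[OF v] by blast
    let ?m = "\<lambda>j. coord.prob (cell (p ^ Suc n) (j * p ^ n + v))"
    have m: "emeasure \<mu> (cylinder p (j # w)) = ennreal (?m j)" if "j < p" for j
      using emeasure_cylinder[of p "j # w"] that p w by (auto simp: words_def)
    have "finite ((\<lambda>(w, i). sibling_ratio p \<mu> w i) ` (words p n \<times> {..<p}))"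
      by (simp add: finite_words)
    then have "balance p \<mu> n \<le> sibling_ratio p \<mu> w i"
      unfolding balance_def using w i by (intro Min_le) auto
    then have ratio: "ennreal C \<le> sibling_ratio p \<mu> w i"
      using C(2)[of n] by (rule order.trans[rotated])
    have "C * ?m i \<le> (\<Sum>j\<in>{..<p} - {i}. ?m j)"
    proof (cases "?m i = 0")
      \<comment> \<open>A null cylinder has ratio infinity and gives no information, but then the
        left-hand side vanishes.\<close>
      case True
      then show ?thesis by (simp add: sum_nonneg)
    next
      case False
      then have mi: "?m i > 0" by (simp add: less_le)
      have "ennreal C \<le> (\<Sum>j\<in>{..<p} - {i}. ennreal (?m j)) / ennreal (?m i)"
        using ratio mi i by (simp add: sibling_ratio_def m)
      also have "\<dots> = ennreal ((\<Sum>j\<in>{..<p} - {i}. ?m j) / ?m i)"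
        using mi by (simp add: sum_ennreal divide_ennreal sum_nonneg)
      finally have "C \<le> (\<Sum>j\<in>{..<p} - {i}. ?m j) / ?m i"
        using mi by (subst (asm) ennreal_le_iff) (auto intro!: divide_nonneg_nonneg sum_nonneg)
      then show ?thesis
        using mi by (simp add: field_simps)
    qed
    moreover have "(\<Sum>j<p. ?m j) = ?m i + (\<Sum>j\<in>{..<p} - {i}. ?m j)"
      using i by (intro sum.remove) auto
    moreover have "(\<Sum>j<p. ?m j) = coord.prob (cell (p ^ n) v)"
      using sum_prob_cell_preimages[of p v "p ^ n"] p v by simp
    ultimately show "?m i \<le> 1 / (1 + C) * coord.prob (cell (p ^ n) v)"
      using C by (simp add: field_simps)
  qed
qed

lemma balanced_geometry_imp_lebesgue:
  assumes p: "p > 1" and q: "q > 1" and cop: "coprime p q"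
    and inv: "times_invariant p \<mu>" "times_invariant q \<mu>"
    and bal: "balanced_geometry p \<mu>"
  shows "\<mu> = lebesgue_circle"
proof -
  obtain c where c: "0 \<le> c" "c < 1" and step: "\<And>n i v. i < p \<Longrightarrow> v < p ^ n \<Longrightarrow>
      coord.prob (cell (p ^ Suc n) (i * p ^ n + v)) \<le> c * coord.prob (cell (p ^ n) v)"
    using balanced_geometry_imp_cell_bound[OF p inv(1) bal] by blast
  \<comment> \<open>Passing to \<open>k mod p ^ (n + L)\<close> strips the leading digit; each of
    the \<open>n\<close> stripped digits costs one factor \<open>c\<close>.\<close>
  have cells: "coord.prob (cell (p ^ (n + L)) k) \<le> c ^ n * coord.prob (cell (p ^ L) (k mod p ^ L))"
    if "k < p ^ (n + L)" for n L k
    using that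
  proof (induction n arbitrary: k)
    case (Suc n)
    let ?P = "p ^ (n + L)"
    have k: "k mod ?P < ?P" "k div ?P < p"
      using Suc.prems p by (auto simp: less_mult_imp_div_less)
    have "coord.prob (cell (p ^ Suc (n + L)) ((k div ?P) * ?P + k mod ?P)) \<le> c * coord.prob (cell ?P (k mod ?P))"
      using k by (intro step)
    also have "\<dots> \<le> c * (c ^ n * coord.prob (cell (p ^ L) ((k mod ?P) mod p ^ L)))"
      using Suc.IH[OF k(1)] c by (intro mult_left_mono)
    also have "(k mod ?P) mod p ^ L = k mod p ^ L"
      by (intro mod_mod_cancel) (simp add: power_add)
    finally show ?case
      by (simp only: div_mult_mod_eq add_Suc power_Suc mult.assoc)
  qed simp
  have "(\<integral>x. circle_char m x \<partial>coord_measure) = 0" if "m \<noteq> 0" for m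
    by (rule coord.integral_circle_char_eq_0[OF p q cop distr_coord_measure_frac[OF inv(2)] c cells that])
  then have eq: "coord_measure = distr (restrict_space lborel {0..<1}) borel (\<lambda>x. x)"
    by (intro coord.eqI_integral_circle_char unit_interval_measure_lborel)
      (simp add: integral_circle_char_lborel)
  have "(\<lambda>x. x) \<in> measurable (restrict_space lborel {0..<1::real}) borel"
    by (rule measurable_restrict_space1) simp
  then have "distr (distr (restrict_space lborel {0..<1}) borel (\<lambda>x. x)) borel to_circle = lebesgue_circle"
    by (simp add: distr_distr o_def lebesgue_circle_def)
  then show ?thesis
    using distr_coord_measure_to_circle by (simp add: eq)
qed

end

theorem theorem1:
  fixes p q :: nat and \<mu> :: "circle measure"
  assumes "p > 1" and "q > 1" and "coprime p q"
    and "prob_space \<mu>" and "sets \<mu> = sets borel"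
    and "\<forall>x. emeasure \<mu> {x} = 0"
    and "times_invariant p \<mu>" and "times_invariant q \<mu>"
    and "balanced_geometry p \<mu> \<or> balanced_geometry q \<mu>"
  shows "\<mu> = lebesgue_circle"
proof -
  interpret nonatomic_circle_measure \<mu>
    using assms(4-6) by (simp add: nonatomic_circle_measure_def nonatomic_circle_measure_axioms_def)
  show ?thesis
    using balanced_geometry_imp_lebesgue[of p q] balanced_geometry_imp_lebesgue[of q p] assms
    by (auto simp: coprime_commute)
qed

end
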